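(* There is an absolute constant $\alpha>0$ (one can choose $\alpha=0.46$) such that the following holds. Let $\kappa>1$ be an integer, let $A=(a_{ij})$ be an $m\times n$ integer matrix and let $$X=\Bigl\{x\in(\mathbb{Z}/\kappa\mathbb{Z})^n,\ x=(\xi_1,\ldots,\xi_n):\ \sum_{j=1}^n a_{ij}\xi_j\equiv 0 \mod \kappa\ \text{ for } i=1,\ldots,m\Bigr\}.$$ Suppose that the number of non-zero entries in every row of $A$ does not exceed $r$ for some $r\geq 2$ and that the number of non-zero entries in every column of $A$ does not exceed $c$ for some $c\geq 1$. If $w_1,\ldots,w_n\in\mathbb{C}$ satisfy $$|w_j|\leq\frac{\alpha}{(\kappa-1)r\sqrt{c}}\quad\text{for } j=1,\ldots,n,$$ then $w(X)\neq 0$.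
   Context: For complex numbers $w_1,\ldots,w_n$ (weights), the weight of a vector $x=(\xi_1,\ldots,\xi_n)\in(\mathbb{Z}/\kappa\mathbb{Z})^n$ is $w(x)=\prod_{j:\ \xi_j\neq 0}w_j$ (the weight of the zero vector is $1$), and the weight of a set $X\subset(\mathbb{Z}/\kappa\mathbb{Z})^n$ is $w(X)=\sum_{x\in X}w(x)$. *)

theory Defs
  imports Complex_Main "HOL-Number_Theory.Residues" "Jordan_Normal_Form.Matrix"
begin

text \<open>An element of \<open>(\<int>/\<kappa>\<int>)\<^sup>n\<close> is an integer vector of dimension \<open>n\<close> whose entries are the
  representatives \<open>0, \<dots>, \<kappa> - 1\<close>, i.e. lie in \<open>carrier (residue_ring \<kappa>)\<close>. In particular an entry is
  zero as an integer iff the residue class is zero.\<close>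

definition residue_vecs :: "int \<Rightarrow> nat \<Rightarrow> int vec set" where
  "residue_vecs \<kappa> n = {x \<in> carrier_vec n. \<forall>j<n. x $ j \<in> carrier (residue_ring \<kappa>)}"

definition solution_set :: "int \<Rightarrow> int mat \<Rightarrow> int vec set" where
  "solution_set \<kappa> A =
     {x \<in> residue_vecs \<kappa> (dim_col A).
        \<forall>i<dim_row A. [(\<Sum>j<dim_col A. A $$ (i, j) * x $ j) = 0] (mod \<kappa>)}"

text \<open>Only the values \<open>w j\<close> with \<open>j < dim_vec x\<close> matter; coordinates are numbered from 0.\<close>

definition vec_weight :: "(nat \<Rightarrow> complex) \<Rightarrow> int vec \<Rightarrow> complex" where
  "vec_weight w x = (\<Prod>j | j < dim_vec x \<and> x $ j \<noteq> 0. w j)"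

definition set_weight :: "(nat \<Rightarrow> complex) \<Rightarrow> int vec set \<Rightarrow> complex" where
  "set_weight w X = (\<Sum>x\<in>X. vec_weight w x)"

text \<open>The property required of the absolute constant: all other parameters, dimensions included,
  are quantified after \<open>\<alpha>\<close>.\<close>

definition nonvanishing_constant :: "real \<Rightarrow> bool" where
  "nonvanishing_constant \<alpha> \<longleftrightarrow>
     (\<forall>(\<kappa>::int) (m::nat) (n::nat) (A::int mat) (r::nat) (c::nat) (w::nat \<Rightarrow> complex).
        \<kappa> > 1 \<longrightarrow> A \<in> carrier_mat m n \<longrightarrow> r \<ge> 2 \<longrightarrow> c \<ge> 1 \<longrightarrow>
        (\<forall>i<m. card {j. j < n \<and> A $$ (i, j) \<noteq> 0} \<le> r) \<longrightarrow>
        (\<forall>j<n. card {i. i < m \<and> A $$ (i, j) \<noteq> 0} \<le> c) \<longrightarrow>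
        (\<forall>j<n. cmod (w j) \<le> \<alpha> / ((real_of_int \<kappa> - 1) * real r * sqrt (real c))) \<longrightarrow>
        set_weight w (solution_set \<kappa> A) \<noteq> 0)"

end

theory Submission 
  imports Defs "HOL-Analysis.Complex_Transcendental"
begin

text \<open>
  Detecting each congruence by the characters of \<open>\<int>/\<kappa>\<int>\<close> turns \<open>\<kappa>\<^sup>m w(X)\<close> into the sum, over
  all \<open>y \<in> (\<int>/\<kappa>\<int>)\<^sup>m\<close>, of \<open>\<Prod>\<^sub>j (1 + u\<^sub>j(y))\<close>, where \<open>u\<^sub>j\<close> depends only on the coordinates \<open>i\<close>
  with \<open>a\<^sub>i\<^sub>j \<noteq> 0\<close> and \<open>\<bar>u\<^sub>j\<bar> \<le> (\<kappa> - 1) \<bar>w\<^sub>j\<bar> \<le> \<delta> = 0.46 / (r \<surd>c)\<close> (\<open>set_weight_Fourier\<close>).  Every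
  factor thus involves at most \<open>c\<close> coordinates, and every coordinate occurs in at most \<open>r\<close> factors.

  For any family of factors of this kind, consider the partial sums over a set \<open>F\<close> of
  coordinates, the others being held fixed.  Induction on \<open>F\<close> shows that such a partial sum is
  nonzero and that it rotates by an angle of at most \<open>\<theta> = 2 / \<surd>c\<close> when one fixed coordinate changes
  (\<open>finite_imp_tame\<close>).

  The first claim follows from the second one for smaller sets: the sum over one more
  coordinate adds vectors that pairwise enclose angles of at most \<open>\<theta> < 2 \<pi> / 3\<close>; hence they lie in a
  common sector of opening \<open>\<theta>\<close>, and at most a factor \<open>cos (\<theta> / 2)\<close> is lost to cancellation
  (\<open>norm_sum_ge_of_within_angle\<close>).

  For the second claim, let the at most \<open>r\<close> factors that see the changing coordinate change one
  at a time.  Changing one factor multiplies each summand by \<open>1 + h\<close> with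
  \<open>\<bar>h\<bar> \<le> 2 \<delta> / (1 - \<delta>)\<close>, where \<open>h\<close> depends on at most \<open>c - 1\<close> coordinates of \<open>F\<close>.  Grouping the
  summands by the values of these coordinates, the cancellation between groups costs at most
  \<open>cos (\<theta> / 2) ^ (c - 1)\<close>, so the relative change is at most
  \<open>2 \<delta> / ((1 - \<delta>) cos (\<theta> / 2) ^ (c - 1))\<close> (\<open>Z_change_one_factor\<close>).  This is where \<open>\<surd>c\<close> comes from:
  with \<open>\<theta>\<close> of order \<open>1 / \<surd>c\<close> the power of the cosine stays bounded below, by about \<open>exp (- 1 / 2)\<close>.
  The constant \<open>0.46\<close> makes the relative change at most \<open>sin \<epsilon>\<close> for \<open>\<epsilon> = \<theta> / r\<close>
  (\<open>step_condition\<close>); each of the at most \<open>r\<close> steps then rotates by at most \<open>\<epsilon>\<close>, which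
  closes the induction.
\<close>

section \<open>Angles between complex numbers\<close>

text \<open>Existence of some logarithm of the quotient with small imaginary part, instead of a bound
  on a normalized argument, makes composition of rotations an addition.\<close>


definition within_angle :: "real \<Rightarrow> complex \<Rightarrow> complex \<Rightarrow> bool" where
  "within_angle \<theta> z z' \<longleftrightarrow> (\<exists>s. \<bar>Im s\<bar> \<le> \<theta> \<and> z = z' * exp s)"

lemma within_angle_refl: "0 \<le> \<theta> \<Longrightarrow> within_angle \<theta> z z"
  unfolding within_angle_def by (intro exI[of _ 0]) auto

lemma within_angle_trans:
  assumes "within_angle \<theta> z1 z2" "within_angle \<eta> z2 z3"
  shows "within_angle (\<theta> + \<eta>) z1 z3"
proof -
  obtain s t where "\<bar>Im s\<bar> \<le> \<theta>" "z1 = z2 * exp s" "\<bar>Im t\<bar> \<le> \<eta>" "z2 = z3 * exp t"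
    using assms unfolding within_angle_def by blast
  then show ?thesis
    unfolding within_angle_def by (intro exI[of _ "t + s"]) (auto simp: exp_add)
qed

lemma within_angle_mono: "within_angle \<theta> z z' \<Longrightarrow> \<theta> \<le> \<eta> \<Longrightarrow> within_angle \<eta> z z'"
  unfolding within_angle_def by (blast intro: order_trans)

text \<open>The disc of radius \<open>sin \<epsilon>\<close> about \<open>1\<close> is seen from the origin under the half-angle \<open>\<epsilon>\<close>.\<close>

lemma within_angle_perturb:
  assumes "z \<noteq> 0" and d: "cmod (z' - z) \<le> sin \<epsilon> * cmod z" and \<epsilon>: "0 \<le> \<epsilon>" "\<epsilon> < pi / 2"
  shows "z' \<noteq> 0" "within_angle \<epsilon> z' z"
proof -
  define q where "q = z' / z"
  define p where "p = sin \<epsilon>"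
  have p: "0 \<le> p" "p < 1"
    using \<epsilon> sin_ge_zero[of \<epsilon>] sin_monotone_2pi[of \<epsilon> "pi/2"] unfolding p_def by auto
  have "cmod (q - 1) = cmod (z' - z) / cmod z"
    using \<open>z \<noteq> 0\<close> by (simp add: q_def norm_divide[symmetric] diff_divide_distrib)
  also have "\<dots> \<le> p"
    using d \<open>z \<noteq> 0\<close> by (simp add: p_def pos_divide_le_eq)
  finally have qd: "cmod (q - 1) \<le> p" .
  have Re: "Re q > 0"
    using abs_Re_le_cmod[of "q - 1"] qd p by auto
  then have "q \<noteq> 0" by auto
  then show "z' \<noteq> 0" by (auto simp: q_def)
  have sq: "(Re q - 1)\<^sup>2 + (Im q)\<^sup>2 \<le> p\<^sup>2"
    using power_mono[OF qd, of 2] by (simp add: cmod_power2)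
  have p2: "1 - p\<^sup>2 \<ge> 0" using p by (simp add: power_le_one)
  \<comment> \<open>The point of the disc with the largest argument is the point of tangency, at real part
     \<open>1 - p\<^sup>2\<close>; the square below measures the distance from it.\<close>
  have "(1 - p\<^sup>2) * (Im q)\<^sup>2 \<le> (1 - p\<^sup>2) * (p\<^sup>2 - (Re q - 1)\<^sup>2)"
    using sq p2 by (intro mult_left_mono) auto
  also have "\<dots> = p\<^sup>2 * (Re q)\<^sup>2 - (Re q - 1 + p\<^sup>2)\<^sup>2"
    by (simp add: power2_eq_square algebra_simps)
  also have "\<dots> \<le> p\<^sup>2 * (Re q)\<^sup>2" by simp
  finally have "(Im q)\<^sup>2 \<le> (p * cmod q)\<^sup>2"
    by (simp add: power_mult_distrib cmod_power2 algebra_simps)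
  then have ImLe: "\<bar>Im q\<bar> \<le> p * cmod q"
    using p by (metis abs_le_square_iff abs_of_nonneg mult_nonneg_nonneg norm_ge_zero)
  define \<phi> where "\<phi> = Im (Ln q)"
  have eq: "q = exp (Ln q)" using \<open>q \<noteq> 0\<close> by simp
  have \<phi>: "\<bar>\<phi>\<bar> < pi / 2" using Re_Ln_pos_lt[OF \<open>q \<noteq> 0\<close>] Re unfolding \<phi>_def by blast
  have "Im q = cmod q * sin \<phi>"
    using eq \<open>q \<noteq> 0\<close> by (metis Im_exp \<phi>_def norm_exp_eq_Re)
  then have sl: "\<bar>sin \<phi>\<bar> \<le> sin \<epsilon>"
    using ImLe \<open>q \<noteq> 0\<close> by (auto simp: abs_mult p_def)
  have "\<phi> \<le> \<epsilon>"
  proof (rule ccontr)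
    assume "\<not> \<phi> \<le> \<epsilon>" then have "sin \<epsilon> < sin \<phi>" using \<phi> \<epsilon> by (intro sin_monotone_2pi) auto
    with sl show False by simp
  qed
  moreover have "-\<phi> \<le> \<epsilon>"
  proof (rule ccontr)
    assume "\<not> -\<phi> \<le> \<epsilon>" then have "sin \<epsilon> < sin (-\<phi>)" using \<phi> \<epsilon> by (intro sin_monotone_2pi) auto
    with sl show False by simp
  qed
  ultimately have "\<bar>\<phi>\<bar> \<le> \<epsilon>" by simp
  then show "within_angle \<epsilon> z' z"
    unfolding within_angle_def using eq \<open>z \<noteq> 0\<close>
    by (intro exI[of _ "Ln q"]) (auto simp: \<phi>_def q_def)
qed

text \<open>If \<open>\<theta> < 2 \<pi> / 3\<close>, pairwise angles of at most \<open>\<theta>\<close> force the vectors into one sector of opening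
  \<open>\<theta>\<close>; projecting on its bisector keeps at least the fraction \<open>cos (\<theta> / 2)\<close> of every length.
  (For \<open>\<theta> = 2 \<pi> / 3\<close> the three cube roots of unity cancel.)\<close>

lemma norm_sum_ge_of_within_angle:
  fixes z :: "'a \<Rightarrow> complex"
  assumes fin: "finite V" "V \<noteq> {}" and nz: "\<And>a. a \<in> V \<Longrightarrow> z a \<noteq> 0"
    and near: "\<And>a b. a \<in> V \<Longrightarrow> b \<in> V \<Longrightarrow> within_angle \<theta> (z a) (z b)"
    and \<theta>: "0 \<le> \<theta>" "3 * \<theta> < 2 * pi"
  shows "cos (\<theta> / 2) * (\<Sum>a\<in>V. cmod (z a)) \<le> cmod (\<Sum>a\<in>V. z a)"
proof -
  obtain o' where o: "o' \<in> V" using fin by blast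
  have "\<forall>a\<in>V. \<exists>s. \<bar>Im s\<bar> \<le> \<theta> \<and> z a = z o' * exp s"
    using near[OF _ o] unfolding within_angle_def by blast
  then obtain s where s: "\<And>a. a \<in> V \<Longrightarrow> \<bar>Im (s a)\<bar> \<le> \<theta>" "\<And>a. a \<in> V \<Longrightarrow> z a = z o' * exp (s a)"
    by metis
  have pair: "\<bar>Im (s a) - Im (s b)\<bar> \<le> \<theta>" if ab: "a \<in> V" "b \<in> V" for a b
  proof -
    obtain t where t: "\<bar>Im t\<bar> \<le> \<theta>" "z a = z b * exp t"
      using near[OF ab] unfolding within_angle_def by blast
    have "exp (s a) = exp (s b + t)"
      using t(2) s(2)[OF ab(1)] s(2)[OF ab(2)] nz[OF o] by (auto simp: exp_add)
    then obtain k :: int where "s a = s b + t + (of_int (2 * k) * pi) * \<i>"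
      unfolding exp_eq by blast
    then have Im: "Im (s a) = Im (s b) + Im t + 2 * pi * k" by simp
    \<comment> \<open>Three angles of at most \<open>\<theta>\<close> cannot add up to a full turn.\<close>
    have "\<bar>2 * pi * k\<bar> < 2 * pi"
      using Im s(1)[OF ab(1)] s(1)[OF ab(2)] t(1) \<theta> by linarith
    then have "\<bar>real_of_int k\<bar> < 1" by (simp add: abs_mult)
    then have "k = 0" by linarith
    with Im t show ?thesis by simp
  qed
  define \<phi> where "\<phi> a = Im (s a)" for a
  define M where "M = (Max (\<phi> ` V) + Min (\<phi> ` V)) / 2"
  have fi: "finite (\<phi> ` V)" "\<phi> ` V \<noteq> {}" using fin by auto
  have "Max (\<phi> ` V) \<in> \<phi> ` V" "Min (\<phi> ` V) \<in> \<phi> ` V"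
    using Max_in[OF fi] Min_in[OF fi] by auto
  then have mm: "Max (\<phi> ` V) - Min (\<phi> ` V) \<le> \<theta>"
    using pair unfolding \<phi>_def by (smt (verit) image_iff)
  have mid: "\<bar>\<phi> a - M\<bar> \<le> \<theta> / 2" if "a \<in> V" for a
  proof -
    have "\<phi> a \<le> Max (\<phi> ` V)" "Min (\<phi> ` V) \<le> \<phi> a"
      using fi that by auto
    then show ?thesis using mm unfolding M_def by (simp add: field_simps abs_le_iff)
  qed
  define q where "q = z o' * exp (\<i> * M)"
  have q: "q \<noteq> 0" using nz[OF o] by (simp add: q_def)
  have each: "cos (\<theta> / 2) * cmod (z a) \<le> cmod q * Re (z a / q)" if a: "a \<in> V" for a
  proof -
    have zq: "z a / q = exp (s a - \<i> * M)"
      using s(2)[OF a] nz[OF o] by (simp add: q_def exp_diff)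
    have "cos (\<theta> / 2) \<le> cos \<bar>\<phi> a - M\<bar>"
      using mid[OF a] \<theta> pi_gt_zero by (intro cos_monotone_0_pi_le) auto
    then have "cos (\<theta> / 2) * cmod (z a / q) \<le> Re (z a / q)"
      unfolding zq by (simp add: Re_exp \<phi>_def mult.commute)
    then show ?thesis using q
      by (simp add: norm_divide divide_simps mult.commute)
  qed
  have "cos (\<theta> / 2) * (\<Sum>a\<in>V. cmod (z a)) \<le> (\<Sum>a\<in>V. cmod q * Re (z a / q))"
    unfolding sum_distrib_left using each by (intro sum_mono) auto
  also have "\<dots> = cmod q * Re ((\<Sum>a\<in>V. z a) / q)"
    by (simp add: sum_distrib_left sum_divide_distrib)
  also have "\<dots> \<le> cmod q * cmod ((\<Sum>a\<in>V. z a) / q)"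
    by (intro mult_left_mono complex_Re_le_cmod) auto
  also have "\<dots> = cmod (\<Sum>a\<in>V. z a)"
    using q by (simp add: norm_divide)
  finally show ?thesis .
qed

section \<open>Sums over some of the coordinates\<close>

definition partial_sum ::
  "'a set \<Rightarrow> 'i set \<Rightarrow> (('i \<Rightarrow> 'a) \<Rightarrow> 'b::comm_monoid_add) \<Rightarrow> ('i \<Rightarrow> 'a) \<Rightarrow> 'b" where
  "partial_sum V F f y = (\<Sum>z\<in>PiE F (\<lambda>_. V). f (override_on y z F))"

lemma partial_sum_empty [simp]: "partial_sum V {} f y = f y"
  by (simp add: partial_sum_def)

lemma partial_sum_insert:
  assumes "i \<notin> F"
  shows "partial_sum V (insert i F) f y = (\<Sum>a\<in>V. partial_sum V F f (y(i := a)))"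
proof -
  have "override_on y (z(i := a)) (insert i F) = override_on (y(i := a)) z F" for a z
    using assms by (auto simp: override_on_def)
  then show ?thesis
    unfolding partial_sum_def PiE_insert_eq
    by (subst sum.reindex[OF inj_combinator[OF assms]])
       (simp add: sum.cartesian_product o_def case_prod_beta)
qed

lemma partial_sum_Un:
  assumes "finite T" "T \<inter> G = {}"
  shows "partial_sum V (T \<union> G) f y = partial_sum V T (partial_sum V G f) y"
  using assms
proof (induction T arbitrary: y)
  case (insert i T)
  then show ?case by (simp add: partial_sum_insert)
qed simp

lemma partial_sum_cong:
  "(\<And>z. f z = g z) \<Longrightarrow> partial_sum V F f y = partial_sum V F g y"
  by (simp add: partial_sum_def)

lemma partial_sum_fun_upd:
  assumes "i \<notin> F"
  shows "partial_sum V F f (y(i := a)) = partial_sum V F (\<lambda>z. f (z(i := a))) y"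
proof -
  have "(override_on y z F)(i := a) = override_on (y(i := a)) z F" for z
    using assms by (auto simp: override_on_def)
  then show ?thesis by (simp add: partial_sum_def)
qed

lemma partial_sum_mono:
  fixes f g :: "('i \<Rightarrow> 'a) \<Rightarrow> real"
  shows "(\<And>z. f z \<le> g z) \<Longrightarrow> partial_sum V F f y \<le> partial_sum V F g y"
  by (simp add: partial_sum_def sum_mono)

lemma partial_sum_mult:
  fixes f :: "('i \<Rightarrow> 'a) \<Rightarrow> 'b::semiring_0"
  shows "partial_sum V F (\<lambda>z. k * f z) y = k * partial_sum V F f y"
  by (simp add: partial_sum_def sum_distrib_left)

lemma partial_sum_diff:
  fixes f :: "('i \<Rightarrow> 'a) \<Rightarrow> 'b::ab_group_add"
  shows "partial_sum V F f y - partial_sum V F g y = partial_sum V F (\<lambda>z. f z - g z) y"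
  by (simp add: partial_sum_def sum_subtractf)

lemma norm_partial_sum_le:
  fixes f :: "('i \<Rightarrow> 'a) \<Rightarrow> complex"
  shows "cmod (partial_sum V F f y) \<le> partial_sum V F (\<lambda>z. cmod (f z)) y"
  by (simp add: partial_sum_def norm_sum)

definition depends_only_on :: "(('i \<Rightarrow> 'a) \<Rightarrow> 'b) \<Rightarrow> 'i set \<Rightarrow> bool" where
  "depends_only_on f S \<longleftrightarrow> (\<forall>y z. (\<forall>i\<in>S. y i = z i) \<longrightarrow> f y = f z)"

lemma depends_only_onD:
  "depends_only_on f S \<Longrightarrow> (\<And>i. i \<in> S \<Longrightarrow> y i = z i) \<Longrightarrow> f y = f z"
  unfolding depends_only_on_def by blast

text \<open>A factor that sees none of the summed coordinates is a constant of the summation.\<close>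

lemma partial_sum_pull_out:
  fixes f h :: "('i \<Rightarrow> 'a) \<Rightarrow> 'b::semiring_0"
  assumes "depends_only_on h S" "S \<inter> F = {}"
  shows "partial_sum V F (\<lambda>z. h z * f z) y = h y * partial_sum V F f y"
proof -
  have "h (override_on y z F) = h y" for z
    using assms(2) by (intro depends_only_onD[OF assms(1)]) (auto simp: override_on_def)
  then show ?thesis by (simp add: partial_sum_def sum_distrib_left)
qed

section \<open>Products of sparse small factors\<close>

text \<open>
  Factor \<open>j\<close> sees the coordinates in \<open>S j\<close>, and each coordinate takes its values in \<open>V\<close>.  Three
  parameters drive the induction: \<open>\<delta>\<close> bounds the deviation of a factor from \<open>1\<close>, \<open>\<epsilon>\<close> the rotation
  caused by changing one factor, and \<open>\<theta>\<close> the rotation caused by changing one coordinate.  The last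
  assumption is what makes a step of the induction reproduce the bound \<open>\<epsilon>\<close>; its exponent is \<open>c - 1\<close>
  because one of the coordinates seen by a changing factor is the changing coordinate itself.
\<close>

locale sparse_product =
  fixes V :: "'a set" and N :: "'j set" and S :: "'j \<Rightarrow> 'i set" and c r :: nat
    and \<delta> \<epsilon> \<theta> :: real
  assumes finV: "finite V" "V \<noteq> {}" and finN: "finite N"
    and finS: "\<And>j. j \<in> N \<Longrightarrow> finite (S j)"
    and cardS: "\<And>j. j \<in> N \<Longrightarrow> card (S j) \<le> c"
    and occ: "\<And>i. card {j \<in> N. i \<in> S j} \<le> r"
    and \<delta>: "0 \<le> \<delta>" "\<delta> < 1"
    and \<epsilon>: "0 \<le> \<epsilon>" "\<epsilon> < pi / 2" and \<theta>: "r * \<epsilon> \<le> \<theta>" "3 * \<theta> < 2 * pi"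
    and step: "2 * \<delta> / (1 - \<delta>) \<le> sin \<epsilon> * cos (\<theta> / 2) ^ (c - 1)"
begin

definition small_factors :: "('j \<Rightarrow> ('i \<Rightarrow> 'a) \<Rightarrow> complex) \<Rightarrow> bool" where
  "small_factors u \<longleftrightarrow> (\<forall>j\<in>N. depends_only_on (u j) (S j) \<and> (\<forall>y. cmod (u j y) \<le> \<delta>))"

definition Z :: "'i set \<Rightarrow> ('j \<Rightarrow> ('i \<Rightarrow> 'a) \<Rightarrow> complex) \<Rightarrow> ('i \<Rightarrow> 'a) \<Rightarrow> complex" where
  "Z F u = partial_sum V F (\<lambda>y. \<Prod>j\<in>N. 1 + u j y)"

text \<open>The induction hypothesis.  It ranges over all families \<open>u\<close> because the
  induction step passes through families with some of the factors modified.\<close>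

definition tame :: "'i set \<Rightarrow> bool" where
  "tame F \<longleftrightarrow> (\<forall>u. small_factors u \<longrightarrow> (\<forall>y. Z F u y \<noteq> 0 \<and>
     (\<forall>i a b. i \<notin> F \<longrightarrow> within_angle \<theta> (Z F u (y(i := a))) (Z F u (y(i := b))))))"

lemma \<theta>0: "0 \<le> \<theta>"
  using \<theta>(1) \<epsilon>(1) by (meson mult_nonneg_nonneg of_nat_0_le_iff order_trans)

lemma cos_half: "0 < cos (\<theta> / 2)" "cos (\<theta> / 2) \<le> 1"
  using \<theta> \<theta>0 by (auto intro!: cos_gt_zero_pi)

lemma one_plus_nonzero: "small_factors u \<Longrightarrow> j \<in> N \<Longrightarrow> 1 + u j y \<noteq> 0"
  unfolding small_factors_def using \<delta>
  by (metis add_eq_0_iff less_le_not_le norm_minus_cancel norm_one)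

lemma Z_insert_ge:
  assumes "tame F" "small_factors u" "i \<notin> F"
  shows "cos (\<theta> / 2) * (\<Sum>a\<in>V. cmod (Z F u (y(i := a)))) \<le> cmod (Z (insert i F) u y)"
proof -
  have "Z (insert i F) u y = (\<Sum>a\<in>V. Z F u (y(i := a)))"
    unfolding Z_def by (rule partial_sum_insert[OF assms(3)])
  then show ?thesis
    using assms by (auto intro!: norm_sum_ge_of_within_angle finV \<theta>0 \<theta>(2) simp: tame_def)
qed

text \<open>Summing the coordinates of \<open>T\<close> one after another costs a factor \<open>cos (\<theta> / 2)\<close> each, so the sum
  over \<open>T\<close> of the absolute values of the inner sums is not much larger than the absolute value of
  the whole sum.\<close>

lemma Z_Un_ge:
  assumes "finite T" "T \<inter> G = {}" and u: "small_factors u"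
    and tame: "\<And>F. F \<subset> T \<union> G \<Longrightarrow> tame F"
  shows "cos (\<theta> / 2) ^ card T * partial_sum V T (\<lambda>z. cmod (Z G u z)) y \<le> cmod (Z (T \<union> G) u y)"
  using assms(1,2,4)
proof (induction T arbitrary: y)
  case (insert i T)
  have i: "i \<notin> T \<union> G" using insert by auto
  have sub: "F \<subset> insert i T \<union> G" if "F \<subseteq> T \<union> G" for F using that i by auto
  have IH: "cos (\<theta> / 2) ^ card T * partial_sum V T (\<lambda>z. cmod (Z G u z)) y' \<le> cmod (Z (T \<union> G) u y')" for y'
    using insert sub by (intro insert.IH) (auto simp: psubset_imp_subset)
  have "cos (\<theta> / 2) ^ card (insert i T) * partial_sum V (insert i T) (\<lambda>z. cmod (Z G u z)) y
      = cos (\<theta> / 2) * (\<Sum>a\<in>V. cos (\<theta> / 2) ^ card T * partial_sum V T (\<lambda>z. cmod (Z G u z)) (y(i := a)))"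
    using insert by (simp add: partial_sum_insert sum_distrib_left mult.assoc)
  also have "\<dots> \<le> cos (\<theta> / 2) * (\<Sum>a\<in>V. cmod (Z (T \<union> G) u (y(i := a))))"
    using cos_half IH by (intro mult_left_mono sum_mono) auto
  also have "\<dots> \<le> cmod (Z (insert i (T \<union> G)) u y)"
    using sub by (intro Z_insert_ge u i insert.prems) auto
  finally show ?case by simp
qed simp

text \<open>The change multiplies each summand by \<open>1 + h\<close>, where \<open>h\<close> is small and sees at most \<open>c - 1\<close>
  summed coordinates \<open>T\<close>.  Summing the other coordinates first leaves \<open>h\<close> constant, and then only
  the sum over \<open>T\<close> has to be estimated by absolute values.\<close>

lemma Z_change_one_factor:
  assumes u: "small_factors u" "small_factors u'"
    and j: "j \<in> N" "\<And>k. k \<in> N \<Longrightarrow> k \<noteq> j \<Longrightarrow> u' k = u k"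
    and F: "finite F" "card (S j \<inter> F) \<le> c - 1"
    and tame: "\<And>G. G \<subset> F \<Longrightarrow> tame G"
  shows "cmod (Z F u' y - Z F u y) \<le> sin \<epsilon> * cmod (Z F u y)"
proof -
  define T G where "T = S j \<inter> F" and "G = F - S j"
  have TG: "T \<union> G = F" "T \<inter> G = {}" "finite T" "S j \<inter> G = {}"
    using F by (auto simp: T_def G_def)
  define h where "h z = (u' j z - u j z) / (1 + u j z)" for z
  define H where "H = 2 * \<delta> / (1 - \<delta>)"
  have H0: "0 \<le> H" using \<delta> by (simp add: H_def)
  have dep: "depends_only_on h (S j)"
    using u j(1) unfolding small_factors_def depends_only_on_def h_def by metis
  have hH: "cmod (h z) \<le> H" for z
  proof -
    have b: "cmod (u j z) \<le> \<delta>" "cmod (u' j z) \<le> \<delta>"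
      using u j(1) by (auto simp: small_factors_def)
    have "cmod (u' j z - u j z) \<le> 2 * \<delta>"
      using norm_triangle_ineq4[of "u' j z" "u j z"] b by simp
    moreover have "1 - \<delta> \<le> cmod (1 + u j z)"
      using norm_diff_ineq[of 1 "u j z"] b by simp
    ultimately show ?thesis
      using \<delta> unfolding h_def H_def norm_divide by (intro frac_le) auto
  qed
  have prod: "(\<Prod>k\<in>N. 1 + u' k z) - (\<Prod>k\<in>N. 1 + u k z) = h z * (\<Prod>k\<in>N. 1 + u k z)" for z
  proof -
    have "(\<Prod>k\<in>N. 1 + u' k z) = (1 + u' j z) * (\<Prod>k\<in>N - {j}. 1 + u k z)"
      using j finN by (subst prod.remove[of N j]) (auto intro!: prod.cong)
    moreover have "(\<Prod>k\<in>N. 1 + u k z) = (1 + u j z) * (\<Prod>k\<in>N - {j}. 1 + u k z)"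
      using j finN by (subst prod.remove[of N j]) auto
    moreover have "u' j z - u j z = h z * (1 + u j z)"
      using one_plus_nonzero[OF u(1) j(1), of z] by (simp add: h_def)
    ultimately show ?thesis
      by (simp add: left_diff_distrib[symmetric] mult.assoc)
  qed
  have "Z F u' y - Z F u y = partial_sum V (T \<union> G) (\<lambda>z. h z * (\<Prod>k\<in>N. 1 + u k z)) y"
    unfolding Z_def partial_sum_diff TG prod ..
  also have "\<dots> = partial_sum V T (\<lambda>z. h z * Z G u z) y"
    unfolding partial_sum_Un[OF TG(3,2)] Z_def
    by (intro partial_sum_cong partial_sum_pull_out[OF dep TG(4)])
  finally have "cmod (Z F u' y - Z F u y) \<le> partial_sum V T (\<lambda>z. cmod (h z * Z G u z)) y"
    by (simp add: norm_partial_sum_le)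
  also have "\<dots> \<le> partial_sum V T (\<lambda>z. H * cmod (Z G u z)) y"
    unfolding norm_mult by (intro partial_sum_mono mult_right_mono hH) auto
  also have "\<dots> = H * partial_sum V T (\<lambda>z. cmod (Z G u z)) y"
    by (rule partial_sum_mult)
  also have "\<dots> \<le> sin \<epsilon> * cos (\<theta> / 2) ^ card T * partial_sum V T (\<lambda>z. cmod (Z G u z)) y"
  proof (rule mult_right_mono)
    have "cos (\<theta> / 2) ^ (c - 1) \<le> cos (\<theta> / 2) ^ card T"
      using F cos_half by (intro power_decreasing) (auto simp: T_def)
    moreover have "0 \<le> sin \<epsilon>" using \<epsilon> by (intro sin_ge_zero) auto
    ultimately show "H \<le> sin \<epsilon> * cos (\<theta> / 2) ^ card T"
      using step unfolding H_def by (meson mult_left_mono order_trans)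
    show "0 \<le> partial_sum V T (\<lambda>z. cmod (Z G u z)) y"
      by (simp add: partial_sum_def sum_nonneg)
  qed
  also have "\<dots> \<le> sin \<epsilon> * cmod (Z F u y)"
  proof -
    have "cos (\<theta> / 2) ^ card T * partial_sum V T (\<lambda>z. cmod (Z G u z)) y \<le> cmod (Z (T \<union> G) u y)"
      using tame TG by (intro Z_Un_ge u) auto
    moreover have "0 \<le> sin \<epsilon>" using \<epsilon> by (intro sin_ge_zero) auto
    ultimately show ?thesis unfolding TG mult.assoc by (rule mult_left_mono)
  qed
  finally show ?thesis .
qed

text \<open>Only the factors that see \<open>i\<close> feel the change of \<open>y i\<close>; there are at most \<open>r\<close> of them, and they
  are switched from the old to the new value one by one.\<close>

lemma Z_rotates_little:
  assumes F: "finite F" "i \<notin> F" and tame: "\<And>G. G \<subset> F \<Longrightarrow> tame G"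
    and nz: "\<And>u y. small_factors u \<Longrightarrow> Z F u y \<noteq> 0" and u: "small_factors u"
  shows "within_angle \<theta> (Z F u (y(i := b))) (Z F u (y(i := a)))"
proof -
  define J where "J = {j \<in> N. i \<in> S j}"
  \<comment> \<open>The factors with index in \<open>K\<close> see the value \<open>b\<close> at \<open>i\<close>, the others see \<open>a\<close>.\<close>
  define v where "v K j z = u j (z(i := if j \<in> K then b else a))" for K j z
  have v: "small_factors (v K)" for K
    using u unfolding small_factors_def v_def depends_only_on_def by (auto simp: fun_upd_apply)
  have "finite J" using finN by (simp add: J_def)
  have walk: "within_angle (card K * \<epsilon>) (Z F (v K) y) (Z F (v {}) y)" if "finite K" "K \<subseteq> J" for K
    using that
  proof (induction K)
    case empty
    show ?case by (simp add: within_angle_refl)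
  next
    case (insert j K)
    have j: "j \<in> N" "i \<in> S j" using insert by (auto simp: J_def)
    \<comment> \<open>\<open>i\<close> is seen by the factor but not summed over.\<close>
    have "card (S j \<inter> F) \<le> card (S j - {i})"
      using finS[OF j(1)] F(2) by (intro card_mono) auto
    also have "\<dots> \<le> c - 1"
      using cardS[OF j(1)] finS[OF j(1)] j(2) by simp
    finally have card: "card (S j \<inter> F) \<le> c - 1" .
    have "cmod (Z F (v (insert j K)) y - Z F (v K) y) \<le> sin \<epsilon> * cmod (Z F (v K) y)"
      using card j F tame by (intro Z_change_one_factor[of _ _ j] v) (auto simp: v_def)
    then have "within_angle \<epsilon> (Z F (v (insert j K)) y) (Z F (v K) y)"
      by (intro within_angle_perturb(2) nz v \<epsilon>)
    from within_angle_trans[OF this insert.IH] insert show ?case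
      by (simp add: algebra_simps)
  qed
  have Za: "Z F u (y(i := a)) = Z F (v {}) y"
    unfolding Z_def v_def by (simp add: partial_sum_fun_upd[OF F(2)])
  have "u j (z(i := b)) = v J j z" if "j \<in> N" for j z
  proof (cases "j \<in> J")
    case False
    then have "i \<notin> S j" using that by (simp add: J_def)
    then show ?thesis
      using u that unfolding v_def small_factors_def
      by (intro depends_only_onD[of "u j" "S j"]) auto
  qed (simp add: v_def)
  then have Zb: "Z F u (y(i := b)) = Z F (v J) y"
    unfolding Z_def partial_sum_fun_upd[OF F(2)] by (intro partial_sum_cong prod.cong) auto
  have "card J * \<epsilon> \<le> \<theta>"
    using occ[of i] \<epsilon> \<theta>(1) unfolding J_def by (meson mult_right_mono of_nat_mono order_trans)
  then show ?thesis
    unfolding Za Zb using walk[OF \<open>finite J\<close> order_refl] within_angle_mono by blast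
qed

theorem finite_imp_tame: "finite F \<Longrightarrow> tame F"
proof (induction F rule: finite_psubset_induct)
  case (psubset F)
  have nz: "Z F u y \<noteq> 0" if u: "small_factors u" for u y
  proof (cases "F = {}")
    case True
    then show ?thesis using one_plus_nonzero[OF u] finN by (simp add: Z_def)
  next
    case False
    then obtain i where i: "i \<in> F" by blast
    define G where "G = F - {i}"
    have G: "F = insert i G" "i \<notin> G" "tame G" using i psubset by (auto simp: G_def)
    have "0 < (\<Sum>a\<in>V. cmod (Z G u (y(i := a))))"
      using G(3) u finV by (intro sum_pos) (auto simp: tame_def)
    then have "0 < cos (\<theta> / 2) * (\<Sum>a\<in>V. cmod (Z G u (y(i := a))))"
      using cos_half by simp
    also have "\<dots> \<le> cmod (Z F u y)"
      unfolding G(1) by (rule Z_insert_ge[OF G(3) u G(2)])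
    finally show ?thesis by auto
  qed
  show ?case
    unfolding tame_def using nz Z_rotates_little psubset by blast
qed

end

section \<open>The constant\<close>

lemma exp_half_le: "exp (1 / 2 :: real) \<le> 5 / 3"
proof -
  have "(exp (1 / 2 :: real))\<^sup>2 = exp 1"
    by (simp add: power2_eq_square exp_add[symmetric])
  also have "\<dots> \<le> (5 / 3)\<^sup>2" using e_less_272 by (simp add: power2_eq_square)
  finally show ?thesis by (rule power2_le_imp_le) simp
qed

lemma cos_ge_one_minus_sq: "1 - x\<^sup>2 / 2 \<le> cos (x :: real)"
proof -
  have "(sin (x / 2))\<^sup>2 \<le> (x / 2)\<^sup>2"
    using abs_sin_x_le_abs_x[of "x / 2"] unfolding abs_le_square_iff .
  then show ?thesis
    using cos_double_sin[of "x / 2"] by (simp add: power2_eq_square)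
qed

lemma sin_ge_cubic:
  fixes x :: real
  assumes "0 \<le> x"
  shows "x * (1 - x\<^sup>2 / 6) \<le> sin x"
proof -
  have "\<bar>sin x - x\<bar> \<le> x * (x * x) / 6"
    using Maclaurin_sin_bound[of x 3] assms by (simp add: numeral_3_eq_3 sin_coeff_def)
  from abs_le_D2[OF this] have "x - x * (x * x) / 6 \<le> sin x" by simp
  then show ?thesis by (simp add: power2_eq_square algebra_simps)
qed

text \<open>By \<open>cos x \<ge> 1 - x\<^sup>2 / 2\<close> and \<open>1 / (1 + h) \<ge> exp (- h)\<close> with \<open>h = 1 / (2 c - 1)\<close>, the power is at least
  \<open>exp (- (c - 1) / (2 c - 1)) \<ge> exp (- 1 / 2) > 0.606\<close>.\<close>

lemma cos_power_ge:
  assumes "c \<ge> (1::nat)"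
  shows "3 / 5 \<le> cos (1 / sqrt c) ^ (c - 1)"
proof -
  define h where "h = 1 / (2 * real c - 1)"
  have h0: "0 < h" using assms by (simp add: h_def)
  have "exp (- h) = 1 / exp h" by (simp add: exp_minus inverse_eq_divide)
  also have "\<dots> \<le> 1 / (1 + h)"
    using h0 exp_ge_add_one_self[of h] by (intro divide_left_mono) auto
  also have "\<dots> = 1 - (1 / sqrt c)\<^sup>2 / 2"
    using assms by (simp add: h_def power_divide field_simps)
  also have "\<dots> \<le> cos (1 / sqrt c)" by (rule cos_ge_one_minus_sq)
  finally have "exp (- h) ^ (c - 1) \<le> cos (1 / sqrt c) ^ (c - 1)"
    by (intro power_mono) auto
  moreover have "exp (- (1 / 2)) \<le> exp (- h) ^ (c - 1)"
    using assms by (simp add: exp_of_nat_mult[symmetric] h_def of_nat_diff field_simps)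
  moreover have "3 / 5 \<le> exp (- (1 / 2) :: real)"
    using exp_half_le by (simp add: exp_minus field_simps)
  ultimately show ?thesis by linarith
qed

text \<open>
  After division by \<open>\<epsilon>\<close> and the estimate \<open>sin \<epsilon> \<ge> \<epsilon> (1 - \<epsilon>\<^sup>2 / 6)\<close> the claim is
  \<open>0.46 \<le> (1 - \<epsilon>\<^sup>2 / 6) (1 - 0.23 \<epsilon>) C\<close>, where \<open>C\<close> is the power of the cosine.  The right-hand side is
  smallest for large \<open>\<epsilon>\<close>.  If \<open>c = 1\<close>, then \<open>\<epsilon> \<le> 1\<close> and \<open>C = 1\<close>; if \<open>c \<ge> 2\<close>, then \<open>\<epsilon> \<le> 1 / \<surd>2\<close>
  compensates for \<open>C\<close> being as small as \<open>0.6\<close>, and the right-hand side is still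
  more than \<open>0.4605\<close>.
\<close>

lemma step_condition:
  fixes c r :: nat
  assumes "c \<ge> 1" "r \<ge> 2"
  defines "\<epsilon> \<equiv> 2 / (real r * sqrt (real c))"
  shows "2 * (0.23 * \<epsilon>) / (1 - 0.23 * \<epsilon>) \<le> sin \<epsilon> * cos (1 / sqrt c) ^ (c - 1)"
proof -
  define C where "C = cos (1 / sqrt c) ^ (c - 1)"
  have \<epsilon>: "0 < \<epsilon>" "\<epsilon> \<le> 1 / sqrt c"
    using assms by (auto simp: \<epsilon>_def divide_simps)
  have C: "3 / 5 \<le> C" unfolding C_def using assms(1) by (rule cos_power_ge)
  have \<epsilon>1: "\<epsilon> \<le> 1"
    using \<epsilon>(2) assms(1) by (smt (verit) divide_le_eq_1 of_nat_1 of_nat_mono real_sqrt_ge_1_iff)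
  have main: "0.46 \<le> (1 - \<epsilon>\<^sup>2 / 6) * (1 - 0.23 * \<epsilon>) * C"
  proof (cases "c = 1")
    case True
    have "\<epsilon>\<^sup>2 \<le> 1" using \<epsilon> \<epsilon>1 by (simp add: power_le_one)
    then have "(5 / 6) * 0.77 \<le> (1 - \<epsilon>\<^sup>2 / 6) * (1 - 0.23 * \<epsilon>)"
      using \<epsilon>1 by (intro mult_mono) auto
    then show ?thesis by (simp add: C_def True)
  next
    case False
    have "\<epsilon>\<^sup>2 \<le> (1 / sqrt c)\<^sup>2" using \<epsilon> by (intro power_mono) auto
    also have "\<dots> \<le> 1 / 2" using False assms(1) by (simp add: power_divide field_simps)
    finally have sq: "\<epsilon>\<^sup>2 \<le> 1 / 2" .
    also have "\<dots> \<le> 0.7072\<^sup>2" by (simp add: power2_eq_square)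
    finally have "\<epsilon> \<le> 0.7072" by (rule power2_le_imp_le) simp
    then have "(11 / 12) * (1 - 0.23 * 0.7072) * (3 / 5) \<le> (1 - \<epsilon>\<^sup>2 / 6) * (1 - 0.23 * \<epsilon>) * C"
      using sq C by (intro mult_mono) auto
    then show ?thesis by simp
  qed
  have "2 * (0.23 * \<epsilon>) = \<epsilon> * 0.46" by simp
  also have "\<dots> \<le> \<epsilon> * ((1 - \<epsilon>\<^sup>2 / 6) * (1 - 0.23 * \<epsilon>) * C)"
    using main \<epsilon> by (intro mult_left_mono) auto
  also have "\<dots> = \<epsilon> * (1 - \<epsilon>\<^sup>2 / 6) * (C * (1 - 0.23 * \<epsilon>))" by simp
  also have "\<dots> \<le> sin \<epsilon> * (C * (1 - 0.23 * \<epsilon>))"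
    using sin_ge_cubic[of \<epsilon>] \<epsilon> \<epsilon>1 C by (intro mult_right_mono) auto
  finally show ?thesis
    using \<epsilon>1 by (simp add: C_def divide_simps mult.assoc)
qed

section \<open>Fourier expansion of the weight of the solution set\<close>

definition unit_char :: "int \<Rightarrow> int \<Rightarrow> complex" where
  "unit_char \<kappa> k = cis (2 * pi * k / \<kappa>)"

lemma norm_unit_char [simp]: "cmod (unit_char \<kappa> k) = 1"
  by (simp add: unit_char_def)

lemma unit_char_0 [simp]: "unit_char \<kappa> 0 = 1"
  by (simp add: unit_char_def)

lemma unit_char_add: "unit_char \<kappa> (k + l) = unit_char \<kappa> k * unit_char \<kappa> l"
  by (simp add: unit_char_def cis_mult ring_distribs add_divide_distrib)

lemma unit_char_sum: "unit_char \<kappa> (\<Sum>x\<in>X. f x) = (\<Prod>x\<in>X. unit_char \<kappa> (f x))"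
  by (induction X rule: infinite_finite_induct) (auto simp: unit_char_add)

lemma unit_char_eq_1_iff:
  assumes "\<kappa> > 0"
  shows "unit_char \<kappa> k = 1 \<longleftrightarrow> \<kappa> dvd k"
proof
  assume "unit_char \<kappa> k = 1"
  then obtain n :: int where "2 * pi * k / \<kappa> = of_int (2 * n) * pi"
    by (auto simp: unit_char_def cis_conv_exp exp_eq_1)
  then have "real_of_int k = of_int (n * \<kappa>)" using assms by (simp add: field_simps)
  then show "\<kappa> dvd k" by (metis dvd_triv_right of_int_eq_iff)
next
  assume "\<kappa> dvd k"
  then obtain n where "k = \<kappa> * n" by blast
  then have "2 * pi * k / \<kappa> = 2 * pi * of_int n" using assms by simp
  then show "unit_char \<kappa> k = 1"
    unfolding unit_char_def by (simp only: cis_multiple_2pi Ints_of_int)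
qed

lemma sum_unit_char:
  assumes "\<kappa> > 0"
  shows "(\<Sum>a\<in>{0..\<kappa> - 1}. unit_char \<kappa> (a * k)) = (if \<kappa> dvd k then of_int \<kappa> else 0)"
proof -
  define q where "q = unit_char \<kappa> k"
  have pow: "unit_char \<kappa> (int a * k) = q ^ a" for a
    by (induction a) (auto simp: q_def unit_char_add ring_distribs)
  have "(\<Sum>a\<in>{0..\<kappa> - 1}. unit_char \<kappa> (a * k)) = (\<Sum>a<nat \<kappa>. q ^ a)"
    unfolding pow[symmetric]
    by (rule sum.reindex_bij_witness[of _ int nat]) (use assms in auto)
  also have "\<dots> = (if \<kappa> dvd k then of_int \<kappa> else 0)"
  proof (cases "\<kappa> dvd k")
    case True
    then have "q = 1" unfolding q_def unit_char_eq_1_iff[OF assms] .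
    then show ?thesis using True assms by simp
  next
    case False
    then have "q \<noteq> 1" unfolding q_def unit_char_eq_1_iff[OF assms] .
    moreover have "q ^ nat \<kappa> = 1"
      unfolding pow[symmetric] using assms by (simp add: unit_char_eq_1_iff)
    ultimately show ?thesis using False by (simp add: geometric_sum)
  qed
  finally show ?thesis .
qed

text \<open>Expanding the product turns the sum over \<open>y\<close> into a sum over \<open>x\<close> and \<open>y\<close> of the weight of \<open>x\<close> times
  \<open>unit_char \<kappa> (y \<bullet> A x)\<close>; by orthogonality the sum over \<open>y\<close> leaves exactly the \<open>x\<close> with
  \<open>A x \<equiv> 0\<close>.\<close>

lemma set_weight_Fourier:
  fixes A :: "int mat"
  assumes \<kappa>: "\<kappa> > 0" and A: "A \<in> carrier_mat m n"
  defines "V \<equiv> {0..\<kappa> - 1}"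
  shows "(\<Sum>y\<in>PiE {..<m} (\<lambda>_. V). \<Prod>j<n. 1 + w j * (\<Sum>\<xi>\<in>V - {0}. unit_char \<kappa> (\<xi> * (\<Sum>i<m. A $$ (i, j) * y i))))
    = of_int \<kappa> ^ m * set_weight w (solution_set \<kappa> A)"
proof -
  define coef where "coef j \<xi> = (if \<xi> = 0 then 1 else w j)" for j and \<xi> :: int
  define s where "s y j = (\<Sum>i<m. A $$ (i, j) * y i)" for y j
  define t where "t x i = (\<Sum>j<n. A $$ (i, j) * x j)" for x i
  define P where "P = PiE {..<n} (\<lambda>_. V)"
  define X where "X = {x \<in> P. \<forall>i<m. \<kappa> dvd t x i}"
  have V: "finite V" "0 \<in> V" using \<kappa> by (auto simp: V_def)
  have P: "finite P" unfolding P_def using V by (intro finite_PiE) auto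
  have factor: "1 + w j * (\<Sum>\<xi>\<in>V - {0}. unit_char \<kappa> (\<xi> * s y j))
      = (\<Sum>\<xi>\<in>V. coef j \<xi> * unit_char \<kappa> (\<xi> * s y j))" for y j
    using V by (simp add: sum.remove[of V 0] coef_def sum_distrib_left)
  have char: "(\<Prod>j<n. unit_char \<kappa> (x j * s y j)) = (\<Prod>i<m. unit_char \<kappa> (y i * t x i))" for x y
    unfolding unit_char_sum[symmetric] s_def t_def sum_distrib_left
    by (subst sum.swap) (simp add: ac_simps)
  have orth: "(\<Sum>y\<in>PiE {..<m} (\<lambda>_. V). \<Prod>i<m. unit_char \<kappa> (y i * t x i))
      = (if \<forall>i<m. \<kappa> dvd t x i then of_int \<kappa> ^ m else 0)" for x
  proof -
    have "(\<Sum>y\<in>PiE {..<m} (\<lambda>_. V). \<Prod>i<m. unit_char \<kappa> (y i * t x i))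
        = (\<Prod>i<m. \<Sum>a\<in>V. unit_char \<kappa> (a * t x i))"
      using V by (subst prod_sum_PiE) auto
    also have "\<dots> = (\<Prod>i<m. if \<kappa> dvd t x i then of_int \<kappa> else 0)"
      unfolding V_def sum_unit_char[OF \<kappa>] ..
    also have "\<dots> = (if \<forall>i<m. \<kappa> dvd t x i then of_int \<kappa> ^ m else 0)"
      by (auto intro!: prod_zero)
    finally show ?thesis .
  qed
  have "(\<Sum>y\<in>PiE {..<m} (\<lambda>_. V). \<Prod>j<n. 1 + w j * (\<Sum>\<xi>\<in>V - {0}. unit_char \<kappa> (\<xi> * s y j)))
      = (\<Sum>y\<in>PiE {..<m} (\<lambda>_. V). \<Sum>x\<in>P. \<Prod>j<n. coef j (x j) * unit_char \<kappa> (x j * s y j))"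
    unfolding factor P_def using V by (subst prod_sum_PiE) auto
  also have "\<dots> = (\<Sum>x\<in>P. (\<Prod>j<n. coef j (x j)) *
      (\<Sum>y\<in>PiE {..<m} (\<lambda>_. V). \<Prod>i<m. unit_char \<kappa> (y i * t x i)))"
    unfolding prod.distrib char by (subst sum.swap) (simp add: sum_distrib_left)
  also have "\<dots> = (\<Sum>x\<in>X. of_int \<kappa> ^ m * (\<Prod>j<n. coef j (x j)))"
    unfolding orth X_def using P by (auto simp: sum.inter_filter intro!: sum.cong)
  also have "\<dots> = of_int \<kappa> ^ m * (\<Sum>x\<in>X. \<Prod>j<n. coef j (x j))"
    by (rule sum_distrib_left[symmetric])
  also have "(\<Sum>x\<in>X. \<Prod>j<n. coef j (x j)) = set_weight w (solution_set \<kappa> A)"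
    unfolding set_weight_def
  proof (rule sum.reindex_bij_witness[of _ "\<lambda>v :: int Matrix.vec. \<lambda>j\<in>{..<n}. v $ j" "\<lambda>x. Matrix.vec n x"])
    fix x assume x: "x \<in> X"
    then show "(\<lambda>j\<in>{..<n}. Matrix.vec n x $ j) = x"
      unfolding X_def P_def by (auto simp: PiE_def extensional_def fun_eq_iff)
    show "Matrix.vec n x \<in> solution_set \<kappa> A"
      using x A unfolding X_def P_def V_def solution_set_def residue_vecs_def t_def
      by (auto simp: residue_ring_def cong_0_iff PiE_iff)
    show "vec_weight w (Matrix.vec n x) = (\<Prod>j<n. coef j (x j))"
    proof -
      have "vec_weight w (Matrix.vec n x) = (\<Prod>j\<in>{j \<in> {..<n}. x j \<noteq> 0}. w j)"
        unfolding vec_weight_def by (intro prod.cong) auto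
      also have "\<dots> = (\<Prod>j<n. if x j \<noteq> 0 then w j else 1)"
        by (rule prod.inter_filter) simp
      also have "\<dots> = (\<Prod>j<n. coef j (x j))"
        by (intro prod.cong) (auto simp: coef_def)
      finally show ?thesis .
    qed
  next
    fix v :: "int Matrix.vec" assume v: "v \<in> solution_set \<kappa> A"
    then have dim: "dim_vec v = n"
      using A by (auto simp: solution_set_def residue_vecs_def)
    show "Matrix.vec n (\<lambda>j\<in>{..<n}. v $ j) = v"
      using dim by auto
    show "(\<lambda>j\<in>{..<n}. v $ j) \<in> X"
      using v A unfolding X_def P_def V_def solution_set_def residue_vecs_def t_def
      by (auto simp: residue_ring_def cong_0_iff)
  qed
  finally show ?thesis by (simp add: s_def)
qed

section \<open>Nonvanishing of the weight\<close>

text \<open>The coordinates of the sparse product are the rows of \<open>A\<close> and its factors are the columns, so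
  the bound on the columns limits what a factor sees, and the bound on the rows limits where a
  coordinate occurs.\<close>

lemma nonvanishing_046: "nonvanishing_constant 0.46"
  unfolding nonvanishing_constant_def
proof (intro allI impI)
  fix \<kappa> :: int and m n :: nat and A :: "int mat" and r c :: nat and w :: "nat \<Rightarrow> complex"
  assume \<kappa>: "\<kappa> > 1" and A: "A \<in> carrier_mat m n" and r: "r \<ge> 2" and c: "c \<ge> 1"
    and row: "\<forall>i<m. card {j. j < n \<and> A $$ (i, j) \<noteq> 0} \<le> r"
    and col: "\<forall>j<n. card {i. i < m \<and> A $$ (i, j) \<noteq> 0} \<le> c"
    and w: "\<forall>j<n. cmod (w j) \<le> 0.46 / ((real_of_int \<kappa> - 1) * real r * sqrt (real c))"
  define \<epsilon> where "\<epsilon> = 2 / (real r * sqrt (real c))"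
  define V where "V = {0..\<kappa> - 1}"
  define S where "S j = {i. i < m \<and> A $$ (i, j) \<noteq> 0}" for j
  define u where "u j y = w j * (\<Sum>\<xi>\<in>V - {0}. unit_char \<kappa> (\<xi> * (\<Sum>i<m. A $$ (i, j) * y i)))"
    for j and y :: "nat \<Rightarrow> int"
  have sc: "1 \<le> sqrt (real c)" using c by simp
  have "2 * 1 \<le> real r * sqrt (real c)" using r sc by (intro mult_mono) auto
  then have \<epsilon>: "0 < \<epsilon>" "\<epsilon> \<le> 1" by (auto simp: \<epsilon>_def divide_simps)
  interpret sparse_product V "{..<n}" S c r "0.23 * \<epsilon>" \<epsilon> "2 / sqrt c"
  proof
    show "finite V" "V \<noteq> {}" using \<kappa> by (auto simp: V_def)
    show "finite {..<n}" by simp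
    show "finite (S j)" if "j \<in> {..<n}" for j by (simp add: S_def)
    show "card (S j) \<le> c" if "j \<in> {..<n}" for j using col that by (simp add: S_def)
    show "card {j \<in> {..<n}. i \<in> S j} \<le> r" for i
      using row by (cases "i < m") (auto simp: S_def)
    show "0 \<le> 0.23 * \<epsilon>" "0.23 * \<epsilon> < 1" "0 \<le> \<epsilon>" using \<epsilon> by auto
    show "\<epsilon> < pi / 2" using \<epsilon> pi_gt3 by simp
    show "real r * \<epsilon> \<le> 2 / sqrt (real c)" using r by (simp add: \<epsilon>_def)
    have "3 * (2 / sqrt c) \<le> 3 * 2" using sc by (simp add: divide_simps)
    then show "3 * (2 / sqrt c) < 2 * pi" using pi_gt3 by linarith
    show "2 * (0.23 * \<epsilon>) / (1 - 0.23 * \<epsilon>) \<le> sin \<epsilon> * cos (2 / sqrt c / 2) ^ (c - 1)"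
      using step_condition[OF c r] by (simp add: \<epsilon>_def)
  qed
  have small: "small_factors u"
    unfolding small_factors_def
  proof (intro ballI conjI allI)
    fix j y assume j: "j \<in> {..<n}"
    show "depends_only_on (u j) (S j)"
      unfolding depends_only_on_def
    proof (intro allI impI)
      fix y z :: "nat \<Rightarrow> int" assume "\<forall>i\<in>S j. y i = z i"
      then have "(\<Sum>i<m. A $$ (i, j) * y i) = (\<Sum>i<m. A $$ (i, j) * z i)"
        by (intro sum.cong) (auto simp: S_def)
      then show "u j y = u j z" by (simp add: u_def)
    qed
    have "cmod (\<Sum>\<xi>\<in>V - {0}. unit_char \<kappa> (\<xi> * (\<Sum>i<m. A $$ (i, j) * y i))) \<le> real (card (V - {0}))"
      by (rule order_trans[OF norm_sum]) simp
    also have "card (V - {0}) = nat (\<kappa> - 1)" using \<kappa> by (simp add: V_def)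
    finally have "cmod (u j y) \<le> cmod (w j) * (real_of_int \<kappa> - 1)"
      using \<kappa> unfolding u_def norm_mult by (intro mult_left_mono) auto
    also have "\<dots> \<le> 0.46 / ((real_of_int \<kappa> - 1) * real r * sqrt (real c)) * (real_of_int \<kappa> - 1)"
      using w j \<kappa> by (intro mult_right_mono) auto
    also have "\<dots> = 0.23 * \<epsilon>" 
    proof -
      have "0.46 / (d * real r * sqrt (real c)) * d = 0.46 / (real r * sqrt (real c))"
        if "d \<noteq> 0" for d :: real using that by simp
      from this[of "real_of_int \<kappa> - 1"] show ?thesis using \<kappa> by (simp add: \<epsilon>_def)
    qed
    finally show "cmod (u j y) \<le> 0.23 * \<epsilon>" .
  qed
  have "(\<Sum>i<m. A $$ (i, j) * override_on y z {..<m} i) = (\<Sum>i<m. A $$ (i, j) * z i)" for j y z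
    by (intro sum.cong) auto
  then have "Z {..<m} u (\<lambda>_. 0) = (\<Sum>y\<in>PiE {..<m} (\<lambda>_. V). \<Prod>j<n. 1 + u j y)"
    unfolding Z_def partial_sum_def u_def by simp
  also have "\<dots> = of_int \<kappa> ^ m * set_weight w (solution_set \<kappa> A)"
    unfolding u_def V_def using \<kappa> A by (intro set_weight_Fourier) auto
  finally show "set_weight w (solution_set \<kappa> A) \<noteq> 0"
    using finite_imp_tame[of "{..<m}"] small unfolding tame_def by (metis finite_lessThan mult_zero_right)
qed

theorem theorem1p6:
  "(\<exists>\<alpha>::real. \<alpha> > 0 \<and> nonvanishing_constant \<alpha>) \<and> nonvanishing_constant 0.46"
  using nonvanishing_046 by (intro conjI exI[of _ "0.46"]) auto

end
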